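(* Let $k\in\mathbb{N}_0$ be fixed. Let $\{P_n\}_{n\ge 0}$ be either the monic Charlier family $\{C_n^{\mu}\}$ (with $\mu>0$) or the monic Meixner family $\{M_n^{\gamma,\mu}\}$ (with $\gamma>0$, $0<\mu<1$), and let $\kappa,\rho,\varphi,\theta_n$ be the corresponding data: $$\text{Charlier: }\ \kappa=-1,\quad \rho=1,\quad \varphi(z)=\varphi_C(z)=\frac{e^{\mu}}{\Gamma(-z)};$$ $$\text{Meixner: }\ \kappa=\mu-1,\quad \rho=1-\mu,\quad \varphi(z)=\varphi_M(z)=\frac{1}{(1-\mu)^{\gamma+z}\,\Gamma(-z)};$$ and $\theta_n(z)=\kappa^n/\Gamma(n-z)$ in both cases. Then, locally uniformly for $z\in\mathbb{C}$, $$\lim_{n\to\infty}\theta_n(z)\,\Delta^k P_n(z)=(-1)^k\varphi(z),$$ $$\lim_{n\to\infty}\frac{\theta_n(z)}{n^k}\,\nabla^k P_n(z)=(-1)^k\varphi(z-k).$$ Moreover, for $k\ge 1$ and $z\notin\{0,1,\dots,k-1\}$, the backward limit satisfies $$(-1)^k\varphi(z-k)=\frac{\rho^k}{[z]_k}\,\varphi(z),$$ that is, $(-1)^k\varphi_C(z-k)=\varphi_C(z)/[z]_k$ in the Charlier case and $(-1)^k\varphi_M(z-k)=(1-\mu)^k\varphi_M(z)/[z]_k$ in the Meixner case. The forward limit is entire (it is the function $\varphi$ up to the factor $(-1)^k$); the apparent singularities of the quotient $\rho^k\varphi(z)/[z]_k$ at $z=0,1,\dots,k-1$ are removable, and the backward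 limit is entire as well.
   Context: $\mathbb{N}_0=\{0,1,2,\dots\}$. Difference operators: $\Delta f(x)=f(x+1)-f(x)$, $\nabla f(x)=f(x)-f(x-1)$, $\Delta^k=\Delta\circ\Delta^{k-1}$, $\nabla^k=\nabla\circ\nabla^{k-1}$, $\Delta^0=\nabla^0=\mathrm{Id}$. Falling factorial: $[x]_0=1$, $[x]_k=\prod_{j=0}^{k-1}(x-j)$ for $k\ge1$. Classical families: the monic polynomials $P_n$ are determined by $P_{-1}=0$, $P_0=1$ and $xP_n(x)=P_{n+1}(x)+\alpha_nP_n(x)+\beta_nP_{n-1}(x)$ for $n\ge 0$, where - monic Charlier $C_n^{\mu}$, $\mu>0$: $\alpha_n=n+\mu$, $\beta_n=n\mu$; - monic Meixner $M_n^{\gamma,\mu}$, $\gamma>0$, $0<\mu<1$: $\alpha_n=\dfrac{n(1+\mu)+\mu\gamma}{1-\mu}$, $\beta_n=\dfrac{n\mu(n-1+\gamma)}{(\mu-1)^2}$. $1/\Gamma$ denotes the entire reciprocal Gamma function (equal to $0$ at nonpositive integers), so $\theta_n$, $\varphi_C$ and $\varphi_M$ are entire functions of $z$. The power $(1-\mu)^{w}$ means $\exp(w\log(1-\mu))$ with the real logarithm. "Locally uniformly" means uniformly on compact subsets of $\mathbb{C}$. *)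

theory Defs
  imports "HOL-Complex_Analysis.Complex_Analysis"
begin

definition fwd_diff :: "('a::comm_ring_1 \<Rightarrow> 'b::ab_group_add) \<Rightarrow> 'a \<Rightarrow> 'b" where
  "fwd_diff f = (\<lambda>x. f (x + 1) - f x)"

definition bwd_diff :: "('a::comm_ring_1 \<Rightarrow> 'b::ab_group_add) \<Rightarrow> 'a \<Rightarrow> 'b" where
  "bwd_diff f = (\<lambda>x. f x - f (x - 1))"

definition falling_fact :: "'a::comm_ring_1 \<Rightarrow> nat \<Rightarrow> 'a" where
  "falling_fact x k = (\<Prod>j<k. x - of_nat j)"

(* The three-term recurrence x P_n = P_(n+1) + \<alpha>_n P_n + \<beta>_n P_(n-1) with P_(-1) = 0, P_0 = 1,
   solved for P_(n+1); see monic_ops_recurrence. *)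
fun monic_ops :: "(nat \<Rightarrow> 'a::comm_ring_1) \<Rightarrow> (nat \<Rightarrow> 'a) \<Rightarrow> nat \<Rightarrow> 'a poly" where
  "monic_ops \<alpha> \<beta> 0 = 1"
| "monic_ops \<alpha> \<beta> (Suc 0) = [:- \<alpha> 0, 1:]"
| "monic_ops \<alpha> \<beta> (Suc (Suc n)) =
     [:- \<alpha> (Suc n), 1:] * monic_ops \<alpha> \<beta> (Suc n) - smult (\<beta> (Suc n)) (monic_ops \<alpha> \<beta> n)"

lemma monic_ops_recurrence:
  "[:0, 1:] * monic_ops \<alpha> \<beta> n =
     monic_ops \<alpha> \<beta> (Suc n) + smult (\<alpha> n) (monic_ops \<alpha> \<beta> n)
       + (if n = 0 then 0 else smult (\<beta> n) (monic_ops \<alpha> \<beta> (n - 1)))"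
  by (cases n) (simp_all add: algebra_simps one_pCons)

definition charlier :: "real \<Rightarrow> nat \<Rightarrow> complex poly" where
  "charlier \<mu> = monic_ops (\<lambda>n. of_real (real n + \<mu>)) (\<lambda>n. of_real (real n * \<mu>))"

definition meixner :: "real \<Rightarrow> real \<Rightarrow> nat \<Rightarrow> complex poly" where
  "meixner \<gamma> \<mu> = monic_ops
     (\<lambda>n. of_real ((real n * (1 + \<mu>) + \<mu> * \<gamma>) / (1 - \<mu>)))
     (\<lambda>n. of_real (real n * \<mu> * (real n - 1 + \<gamma>) / (\<mu> - 1)\<^sup>2))"

definition charlier_phi :: "real \<Rightarrow> complex \<Rightarrow> complex" where
  "charlier_phi \<mu> z = of_real (exp \<mu>) * rGamma (- z)"

definition meixner_phi :: "real \<Rightarrow> real \<Rightarrow> complex \<Rightarrow> complex" where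
  "meixner_phi \<gamma> \<mu> z = rGamma (- z) / exp ((of_real \<gamma> + z) * of_real (ln (1 - \<mu>)))"

definition theta :: "real \<Rightarrow> nat \<Rightarrow> complex \<Rightarrow> complex" where
  "theta \<kappa> n z = of_real \<kappa> ^ n * rGamma (of_nat n - z)"

(* The value of f at z0 itself is irrelevant here (for a quotient with vanishing denominator
   it is the HOL convention x / 0 = 0). *)
definition removable_sing_at :: "(complex \<Rightarrow> complex) \<Rightarrow> complex \<Rightarrow> bool" where
  "removable_sing_at f z0 \<longleftrightarrow>
     (\<exists>r>0. \<exists>g. g holomorphic_on ball z0 r \<and> (\<forall>z\<in>ball z0 r - {z0}. g z = f z))"

end

theory Submission
  imports Defs
begin

text \<open>
  Both families have a generating function of the same shape. With the constant \<open>\<kappa>\<close> of the family,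
  the sum over \<open>n\<close> of \<open>\<kappa> ^ n * P_n(z) * t ^ n / n!\<close> is \<open>(1 - t) powr z * w(t)\<close>, where \<open>w(t)\<close> is
  \<open>exp (\<mu> t)\<close> for Charlier and \<open>(1 - \<mu> t) powr (- \<gamma> - z)\<close> for Meixner. This follows by comparing
  three-term recurrences (\<open>conv_coeff_recurrence\<close>, \<open>monic_ops_eq_conv_coeff\<close>).

  The factor \<open>w\<close> is analytic beyond the unit circle, so Darboux's principle says that the coefficient
  of \<open>t ^ n\<close> behaves like \<open>w(1)\<close> times the coefficient of \<open>(1 - t) powr z\<close>, which is
  \<open>\<Gamma>(n - z) / (n! * \<Gamma>(- z))\<close>. Multiplying by \<open>n! / \<Gamma>(n - z)\<close> gives the limit \<open>w(1) / \<Gamma>(- z)\<close>, which is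
  the function \<open>\<phi>\<close>. To have this locally uniformly and also at the poles of \<open>\<Gamma>\<close>, the coefficient is
  written as a finite convolution sum and Tannery's theorem is used in a uniform form
  (\<open>uniform_tannery\<close>, \<open>uniform_limit_conv_coeff\<close>), with a dominating bound from the functional
  equation of \<open>1 / \<Gamma>\<close> (\<open>fact_rGamma_bound\<close>).

  The step from \<open>k = 0\<close> to arbitrary \<open>k\<close> is independent of the polynomials. In a forward difference
  the shifted term is smaller by a factor of order \<open>1 / n\<close> after multiplication by \<open>theta\<close>, so each
  difference just changes the sign of the limit (\<open>fwd_diff_limit\<close>). Backward differences are forward
  differences at \<open>z - k\<close>, and \<open>theta\<close> at \<open>z\<close> exceeds \<open>theta\<close> at \<open>z - k\<close> by a factor asymptotic to
  \<open>n ^ k\<close> (\<open>bwd_diff_limit\<close>). The closed form of the backward limit is the functional equation of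
  \<open>1 / \<Gamma>\<close>; it also exhibits the entire function that removes the singularities of the quotient.
\<close>

section \<open>Coefficients of the generating functions\<close>

text \<open>
  The Taylor coefficients at \<open>t = 0\<close> of the solution \<open>w\<close> of \<open>(1 - c t) w' = d w\<close> with
  \<open>w(0) = 1\<close>: this is \<open>(1 - c t) powr (- d / c)\<close>, or \<open>exp (d t)\<close> if \<open>c = 0\<close>. Allowing \<open>c = 0\<close>
  treats the exponential factor of the Charlier case and the binomial factor of the Meixner
  case together; \<open>c = 1\<close> and \<open>d = - z\<close> give \<open>(1 - t) powr z\<close>, which both cases share.
\<close>
definition hyp_coeff :: "'a::field_char_0 \<Rightarrow> 'a \<Rightarrow> nat \<Rightarrow> 'a" where
  "hyp_coeff c d j = (\<Prod>i<j. d + of_nat i * c) / fact j"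

lemma hyp_coeff_0 [simp]: "hyp_coeff c d 0 = 1"
  by (simp add: hyp_coeff_def)

lemma hyp_coeff_Suc: "of_nat (Suc j) * hyp_coeff c d (Suc j) = (d + of_nat j * c) * hyp_coeff c d j"
  by (simp add: hyp_coeff_def field_simps del: of_nat_Suc)

lemma hyp_coeff_pochhammer: "hyp_coeff 1 d j = pochhammer d j / fact j"
  by (simp add: hyp_coeff_def pochhammer_prod atLeast0LessThan)

text \<open>
  The triangle inequality in each factor. The bound depends on \<open>d\<close> only through \<open>D\<close>, so it is
  uniform in \<open>z\<close> when \<open>d\<close> is a function of \<open>z\<close> on a compact set.
\<close>
lemma norm_hyp_coeff_le:
  fixes c d :: complex
  assumes "norm d \<le> D"
  shows "norm (hyp_coeff c d j) \<le> hyp_coeff (norm c) D j"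
proof -
  have "norm (\<Prod>i<j. d + of_nat i * c) \<le> (\<Prod>i<j. D + of_nat i * norm c)"
    unfolding prod_norm[symmetric]
  proof (rule prod_mono, safe)
    fix i
    show "norm (d + of_nat i * c) \<le> D + of_nat i * norm c"
      using norm_triangle_ineq[of d "of_nat i * c"] assms by (simp add: norm_mult)
  qed auto
  thus ?thesis
    by (simp add: hyp_coeff_def norm_divide divide_right_mono)
qed

text \<open>
  The ratio of consecutive terms tends to \<open>c q\<close>. In the application \<open>q > 1\<close>, which leaves room
  for a factor that grows slowly but exponentially.
\<close>
lemma summable_hyp_coeff:
  fixes c D q :: real
  assumes "0 \<le> c" "0 \<le> D" "0 \<le> q" "c * q < 1"
  shows "summable (\<lambda>j. hyp_coeff c D j * q ^ j)"
proof -
  \<comment> \<open>any ratio strictly between the limiting ratio \<open>c q\<close> and 1\<close>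
  define s where "s = (1 + c * q) / 2"
  have s: "s < 1" "c * q < s" using assms by (auto simp: s_def)
  obtain N :: nat where N: "N * (s - c * q) \<ge> D * q"
    using reals_Archimedean3[of "s - c * q"] s by (metis diff_gt_0_iff_gt less_imp_le)
  show ?thesis
  proof (rule summable_ratio_test[OF s(1)])
    fix n assume n: "n \<ge> N"
    have pos: "hyp_coeff c D m \<ge> 0" for m
      using assms by (auto simp: hyp_coeff_def intro!: divide_nonneg_nonneg prod_nonneg)
    have "D * q \<le> real n * (s - c * q)"
      using N n s by (meson diff_ge_0_iff_ge less_imp_le mult_right_mono of_nat_le_iff order_trans)
    hence "(D + n * c) * q \<le> s * Suc n"
      using s mult_nonneg_nonneg[OF assms(1,3)] by (simp add: algebra_simps)
    hence *: "(D + n * c) * q * (hyp_coeff c D n * q ^ n) \<le> s * Suc n * (hyp_coeff c D n * q ^ n)"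
      using pos assms by (intro mult_right_mono) auto
    have "Suc n * (hyp_coeff c D (Suc n) * q ^ Suc n) = (D + n * c) * q * (hyp_coeff c D n * q ^ n)"
      using arg_cong[OF hyp_coeff_Suc[of n c D], of "\<lambda>x. x * (q * q ^ n)"]
      by (simp only: mult_ac power_Suc)
    hence "Suc n * (hyp_coeff c D (Suc n) * q ^ Suc n) \<le> Suc n * (s * (hyp_coeff c D n * q ^ n))"
      using * by (simp add: algebra_simps del: of_nat_Suc)
    hence "hyp_coeff c D (Suc n) * q ^ Suc n \<le> s * (hyp_coeff c D n * q ^ n)"
      by (subst (asm) mult_le_cancel_left_pos) auto
    thus "norm (hyp_coeff c D (Suc n) * q ^ Suc n) \<le> s * norm (hyp_coeff c D n * q ^ n)"
      using pos assms by (simp add: abs_mult)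
  qed
qed

lemma hyp_coeff_fps_ode:
  "(1 - fps_const c * fps_X) * fps_deriv (Abs_fps (hyp_coeff c d)) = fps_const d * Abs_fps (hyp_coeff c d)"
proof (rule fps_ext)
  fix n
  show "((1 - fps_const c * fps_X) * fps_deriv (Abs_fps (hyp_coeff c d))) $ n
          = (fps_const d * Abs_fps (hyp_coeff c d)) $ n"
    using hyp_coeff_Suc[of n c d]
    by (cases n) (simp_all add: algebra_simps mult.assoc[of "fps_const _"] del: of_nat_Suc)
qed

section \<open>The recurrence solved by a generating function\<close>

text \<open>
  The coefficient of \<open>t ^ n\<close> in \<open>(1 - c t) powr (- d / c) * (1 - t) powr z\<close>, the first factor being
  \<open>exp (d t)\<close> if \<open>c = 0\<close>.
\<close>
definition conv_coeff :: "'a::field_char_0 \<Rightarrow> 'a \<Rightarrow> 'a \<Rightarrow> nat \<Rightarrow> 'a" where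
  "conv_coeff c d z n = (\<Sum>j\<le>n. hyp_coeff c d j * hyp_coeff 1 (- z) (n - j))"

text \<open>
  The two factors satisfy first-order linear differential equations, hence so does their product
  \<open>G\<close>, namely \<open>(1 - t) (1 - c t) G' = (d (1 - t) - z (1 - c t)) G\<close>. Its coefficients are
  quadratic and linear in \<open>t\<close>, so comparing coefficients of \<open>t ^ n\<close> gives a three-term recurrence.
\<close>
lemma conv_coeff_recurrence:
  "of_nat (Suc n) * conv_coeff c d z (Suc n) =
     (of_nat n * (1 + c) + d - z) * conv_coeff c d z n
     - (if n = 0 then 0 else (of_nat (n - 1) * c + d - c * z) * conv_coeff c d z (n - 1))"
proof -
  define W where "W = Abs_fps (hyp_coeff c d)"
  define V where "V = Abs_fps (hyp_coeff 1 (- z))"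
  define G where "G = W * V"
  have G: "G $ m = conv_coeff c d z m" for m
    by (simp add: G_def W_def V_def fps_mult_nth conv_coeff_def atLeast0AtMost)
  have W: "(1 - fps_const c * fps_X) * fps_deriv W = fps_const d * W"
    unfolding W_def by (rule hyp_coeff_fps_ode)
  have V: "(1 - fps_X) * fps_deriv V = - (fps_const z * V)"
    unfolding V_def using hyp_coeff_fps_ode[of 1 "- z"] by (simp flip: fps_const_neg)
  have "(1 - fps_X) * (1 - fps_const c * fps_X) * fps_deriv G
      = V * (1 - fps_X) * ((1 - fps_const c * fps_X) * fps_deriv W)
        + W * (1 - fps_const c * fps_X) * ((1 - fps_X) * fps_deriv V)"
    by (simp add: G_def algebra_simps)
  also have "\<dots> = (fps_const d * (1 - fps_X) - fps_const z * (1 - fps_const c * fps_X)) * G"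
    unfolding W V by (simp add: G_def algebra_simps)
  finally have "fps_deriv G = fps_const (1 + c) * (fps_X * fps_deriv G)
      - fps_const c * (fps_X * (fps_X * fps_deriv G))
      + fps_const (d - z) * G - fps_const (d - c * z) * (fps_X * G)"
    by (simp add: algebra_simps flip: fps_const_add fps_const_sub fps_const_mult)
  from arg_cong[OF this, of "\<lambda>F. F $ n"] show ?thesis
    by (cases n; cases "n - 1") (simp_all add: G algebra_simps)
qed

text \<open>
  After multiplication by \<open>\<kappa> ^ n / fact n\<close> the recurrence of the orthogonal polynomials is the one
  above. Here \<open>z\<close> is fixed and \<open>d\<close> may depend on it: the hypotheses only compare the
  coefficients of the two recurrences at the given point.
\<close>
lemma monic_ops_eq_conv_coeff:
  fixes \<kappa> c d z :: "'a::field_char_0"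
  assumes \<alpha>: "\<And>n. \<kappa> * (z - \<alpha> n) = of_nat n * (1 + c) + d - z"
    and \<beta>: "\<And>n. \<kappa>\<^sup>2 * \<beta> (Suc n) = of_nat (Suc n) * (of_nat n * c + d - c * z)"
  shows "\<kappa> ^ n * poly (monic_ops \<alpha> \<beta> n) z = fact n * conv_coeff c d z n"
proof (induction n rule: induct_nat_012)
  case 0
  show ?case by (simp add: conv_coeff_def)
next
  case 1
  have "conv_coeff c d z (Suc 0) = d - z"
    using conv_coeff_recurrence[of 0 c d z] by (simp add: conv_coeff_def)
  thus ?case using \<alpha>[of 0] by (simp add: right_diff_distrib)
next
  case (ge2 n)
  have "\<kappa> ^ Suc (Suc n) * poly (monic_ops \<alpha> \<beta> (Suc (Suc n))) z
      = (\<kappa> * (z - \<alpha> (Suc n))) * (\<kappa> ^ Suc n * poly (monic_ops \<alpha> \<beta> (Suc n)) z)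
        - (\<kappa>\<^sup>2 * \<beta> (Suc n)) * (\<kappa> ^ n * poly (monic_ops \<alpha> \<beta> n) z)"
    by (simp add: algebra_simps power2_eq_square)
  also have "\<dots> = fact (Suc n) * ((of_nat (Suc n) * (1 + c) + d - z) * conv_coeff c d z (Suc n)
        - (of_nat n * c + d - c * z) * conv_coeff c d z n)"
    unfolding ge2 \<alpha> \<beta> by (simp add: algebra_simps)
  also have "\<dots> = fact (Suc n) * (of_nat (Suc (Suc n)) * conv_coeff c d z (Suc (Suc n)))"
    by (subst conv_coeff_recurrence) simp
  finally show ?case by (simp add: algebra_simps)
qed

section \<open>Uniform limits of series and of elementary quotients\<close>

text \<open>
  Uniform convergence is ordinary convergence to 0 along a product filter, so theorems about
  limits along arbitrary filters become theorems about uniform limits.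
\<close>
lemma uniform_limit_iff_filterlim_principal:
  fixes f :: "'i \<Rightarrow> 'a \<Rightarrow> 'b::real_normed_vector"
  shows "uniform_limit K f l F \<longleftrightarrow>
    ((\<lambda>(n, x). f n x - l x) \<longlongrightarrow> 0) (F \<times>\<^sub>F principal K)"
proof -
  have "eventually P (F \<times>\<^sub>F principal K) \<longleftrightarrow> (\<forall>\<^sub>F n in F. \<forall>x\<in>K. P (n, x))"
    for P :: "'i \<times> 'a \<Rightarrow> bool"
  proof
    assume "eventually P (F \<times>\<^sub>F principal K)"
    then obtain Q R where "eventually Q F" "\<forall>x\<in>K. R x" "\<And>n x. Q n \<Longrightarrow> R x \<Longrightarrow> P (n, x)"
      unfolding eventually_prod_filter eventually_principal by blast
    thus "\<forall>\<^sub>F n in F. \<forall>x\<in>K. P (n, x)" by (auto elim: eventually_mono)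
  next
    assume "\<forall>\<^sub>F n in F. \<forall>x\<in>K. P (n, x)"
    thus "eventually P (F \<times>\<^sub>F principal K)"
      unfolding eventually_prod_filter eventually_principal
      by (intro exI[of _ "\<lambda>n. \<forall>x\<in>K. P (n, x)"] exI[of _ "\<lambda>x. x \<in> K"]) auto
  qed
  thus ?thesis
    by (simp add: uniform_limit_iff tendsto_iff dist_norm)
qed

text \<open>
  Tannery's theorem along the product filter. There the limit of each term may not depend on the
  point \<open>x\<close>, which is why it is applied to the differences \<open>a j n x - g j x\<close>, with limit 0.
\<close>
lemma uniform_tannery:
  fixes a :: "nat \<Rightarrow> nat \<Rightarrow> 'a \<Rightarrow> 'b::{real_normed_algebra,banach}"
  assumes lim: "\<And>j. uniform_limit K (a j) (g j) sequentially"
    and bound: "\<And>j n x. x \<in> K \<Longrightarrow> norm (a j n x) \<le> M j"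
    and M: "summable M"
  shows "uniform_limit K (\<lambda>n x. \<Sum>j. a j n x) (\<lambda>x. \<Sum>j. g j x) sequentially"
proof (cases "K = {}")
  case False
  define F where "F = sequentially \<times>\<^sub>F principal K"
  have g: "norm (g j x) \<le> M j" if "x \<in> K" for j x
    by (rule tendsto_upperbound[OF tendsto_norm[OF tendsto_uniform_limitI[OF lim that]]])
       (use bound that in auto)
  have ev: "\<forall>\<^sub>F y in F. snd y \<in> K"
    unfolding F_def eventually_prod_filter eventually_principal
    by (rule exI[of _ "\<lambda>_. True"], rule exI[of _ "\<lambda>x. x \<in> K"]) auto
  have "((\<lambda>y. \<Sum>j. a j (fst y) (snd y) - g j (snd y)) \<longlongrightarrow> (\<Sum>j. 0)) F"
  proof (rule tannerys_theorem[THEN conjunct2, THEN conjunct2])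
    show "((\<lambda>y. a j (fst y) (snd y) - g j (snd y)) \<longlongrightarrow> 0) F" for j
      using lim[of j] unfolding uniform_limit_iff_filterlim_principal F_def
      by (simp add: case_prod_unfold)
    have "norm (a j n x - g j x) \<le> 2 * M j" if "x \<in> K" for j n x
      using norm_triangle_ineq4[of "a j n x" "g j x"] bound[OF that, of j n] g[OF that, of j] by linarith
    hence "\<forall>\<^sub>F y in F. \<forall>j. norm (a j (fst y) (snd y) - g j (snd y)) \<le> 2 * M j"
      using ev by (auto elim!: eventually_mono)
    hence "\<forall>\<^sub>F (j :: nat, y) in at_top \<times>\<^sub>F F. \<forall>j. norm (a j (fst y) (snd y) - g j (snd y)) \<le> 2 * M j"
      by (subst eventually_prod2) auto
    thus "\<forall>\<^sub>F (j, y) in at_top \<times>\<^sub>F F. norm (a j (fst y) (snd y) - g j (snd y)) \<le> 2 * M j"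
      by (rule eventually_mono) auto
    show "summable (\<lambda>j. 2 * M j)" using M by (rule summable_mult)
    show "F \<noteq> bot" using False by (simp add: F_def prod_filter_eq_bot principal_eq_bot_iff)
  qed
  moreover have "(\<Sum>j. a j n x - g j x) = (\<Sum>j. a j n x) - (\<Sum>j. g j x)" if "x \<in> K" for n x
    by (rule suminf_diff[symmetric];
        rule summable_comparison_test'[OF M]; use bound g that in auto)
  hence "\<forall>\<^sub>F y in F. (\<Sum>j. a j (fst y) (snd y) - g j (snd y))
      = (case y of (n, x) \<Rightarrow> (\<Sum>j. a j n x) - (\<Sum>j. g j x))"
    using ev by (auto elim!: eventually_mono)
  ultimately show ?thesis
    unfolding uniform_limit_iff_filterlim_principal F_def[symmetric]
    by (simp add: tendsto_cong)
qed auto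

lemma eventually_of_nat_minus_ge:
  fixes K :: "complex set"
  assumes "bounded K"
  shows "\<forall>\<^sub>F n in sequentially. \<forall>z\<in>K. norm (of_nat n - z) \<ge> B"
proof -
  obtain r where r: "\<And>z. z \<in> K \<Longrightarrow> norm z \<le> r"
    using assms bounded_iff by blast
  obtain N :: nat where N: "B + r \<le> N" using real_arch_simple by blast
  show ?thesis
    using eventually_ge_at_top[of N]
  proof eventually_elim
    case (elim n)
    show ?case
    proof
      fix z assume "z \<in> K"
      moreover have "norm (of_nat n :: complex) - norm z \<le> norm (of_nat n - z)"
        by (rule norm_triangle_ineq2)
      moreover have "real N \<le> n" using elim by simp
      ultimately show "B \<le> norm (of_nat n - z)" using r[of z] N by simp
    qed
  qed
qed

lemma uniform_limit_inverse_of_nat_minus: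
  fixes K :: "complex set"
  assumes "bounded K"
  shows "uniform_limit K (\<lambda>n z. 1 / (of_nat n - z)) (\<lambda>_. 0) sequentially"
proof (rule uniform_limitI)
  fix e :: real assume e: "e > 0"
  from eventually_of_nat_minus_ge[OF assms, of "2 / e"]
  show "\<forall>\<^sub>F n in sequentially. \<forall>z\<in>K. dist (1 / (of_nat n - z)) 0 < e"
  proof eventually_elim
    case (elim n)
    show ?case
    proof
      fix z assume "z \<in> K"
      hence "2 / e \<le> norm (of_nat n - z)" using elim by blast
      moreover have "0 < 2 / e" using e by simp
      ultimately have "0 < norm (of_nat n - z)" "2 \<le> norm (of_nat n - z) * e"
        using e by (linarith, simp add: pos_divide_le_eq)
      thus "dist (1 / (of_nat n - z)) 0 < e"
        by (simp add: norm_divide pos_divide_less_eq mult.commute)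
    qed
  qed
qed

text \<open>
  The quotient equals \<open>1 + (1 + z) / (n - z)\<close>.
\<close>
lemma uniform_limit_Suc_ratio:
  fixes K :: "complex set"
  assumes "bounded K"
  shows "uniform_limit K (\<lambda>n z. of_nat (Suc n) / (of_nat n - z)) (\<lambda>_. 1) sequentially"
proof -
  have "bounded ((\<lambda>z. 1 + z) ` K)"
    using bounded_translation[OF assms] by simp
  hence "uniform_limit K (\<lambda>n z. 1 + (1 + z) * (1 / (of_nat n - z))) (\<lambda>z. 1 + (1 + z) * 0) sequentially"
    by (intro uniform_limit_add uniform_lim_mult uniform_limit_const
        uniform_limit_inverse_of_nat_minus assms) (auto simp: image_constant_conv)
  moreover have "\<forall>\<^sub>F n in sequentially. \<forall>z\<in>K.
      1 + (1 + z) * (1 / (of_nat n - z)) = of_nat (Suc n) / (of_nat n - z)"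
    using eventually_of_nat_minus_ge[OF assms, of 1]
  proof eventually_elim
    case (elim n)
    hence "of_nat n - z \<noteq> 0" if "z \<in> K" for z using that by fastforce
    thus ?case by (auto simp: field_simps)
  qed
  ultimately show ?thesis
    by (subst (asm) uniform_limit_cong) auto
qed

section \<open>Ratio asymptotics of the reciprocal Gamma function\<close>

text \<open>
  The factor \<open>n! / \<Gamma>(n - z)\<close> that normalizes the coefficient of \<open>t ^ n\<close>: that of
  \<open>(1 - t) powr z\<close> times this factor is exactly \<open>1 / \<Gamma>(- z)\<close>, also at the zeros of the latter.
\<close>
definition fact_rGamma :: "nat \<Rightarrow> complex \<Rightarrow> complex" where
  "fact_rGamma n z = fact n * rGamma (of_nat n - z)"

lemma fact_rGamma_Suc:
  assumes "of_nat n - z \<noteq> 0"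
  shows "fact_rGamma (Suc n) z = of_nat (Suc n) / (of_nat n - z) * fact_rGamma n z"
  using assms rGamma_plus1[of "of_nat n - z"]
  by (simp add: fact_rGamma_def field_simps)

lemma hyp_coeff_mult_fact_rGamma: "hyp_coeff 1 (- z) m * fact_rGamma m z = rGamma (- z)"
  using pochhammer_rGamma[of "- z" m] by (simp add: hyp_coeff_pochhammer fact_rGamma_def algebra_simps)

lemma continuous_on_rGamma_compose [continuous_intros]:
  assumes "continuous_on A f"
  shows "continuous_on A (\<lambda>x. rGamma (f x :: complex))"
  by (rule continuous_on_compose2[OF continuous_on_rGamma assms subset_UNIV])

text \<open>
  The dominating bound for Tannery's theorem. Raising \<open>n\<close> by one multiplies \<open>fact_rGamma n z\<close> by
  \<open>(n + 1) / (n - z)\<close>, which has modulus at most \<open>q\<close> from some \<open>N\<close> on, uniformly in \<open>z\<close>.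
  Starting at \<open>n = m\<close>, where the product is \<open>1 / \<Gamma>(- z)\<close>, one loses at most \<open>q ^ j\<close>. Only the
  region below \<open>N\<close>, where \<open>n - z\<close> may vanish, needs care; it contributes finitely many continuous
  functions on \<open>K\<close>, which are bounded.
\<close>
lemma fact_rGamma_bound:
  assumes K: "compact K" and q: "q > 1"
  shows "\<exists>C. \<forall>m j. \<forall>z\<in>K. norm (hyp_coeff 1 (- z) m * fact_rGamma (m + j) z) \<le> C * q ^ j"
proof -
  have bK: "bounded K" using K by (rule compact_imp_bounded)
  have "\<forall>\<^sub>F n in sequentially. \<forall>z\<in>K. norm (of_nat n - z) \<ge> 1 \<and> norm (of_nat (Suc n) / (of_nat n - z)) \<le> q"
    using eventually_of_nat_minus_ge[OF bK, of 1]
      uniform_limitD[OF uniform_limit_Suc_ratio[OF bK] diff_gt_0_iff_gt[THEN iffD2, OF q]]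
  proof eventually_elim
    case (elim n)
    show ?case
    proof (safe)
      fix z assume z: "z \<in> K"
      show "1 \<le> norm (of_nat n - z)" using elim z by blast
      have "norm (of_nat (Suc n) / (of_nat n - z) - 1) < q - 1"
        using elim(2) q z by (simp only: dist_norm)
      thus "norm (of_nat (Suc n) / (of_nat n - z)) \<le> q"
        using norm_triangle_ineq2[of "of_nat (Suc n) / (of_nat n - z)" 1] by simp
    qed
  qed
  then obtain N where N: "\<And>n z. n \<ge> N \<Longrightarrow> z \<in> K \<Longrightarrow>
      norm (of_nat n - z) \<ge> 1 \<and> norm (of_nat (Suc n) / (of_nat n - z)) \<le> q"
    unfolding eventually_sequentially by blast
  have growth: "norm (fact_rGamma (n + j) z) \<le> norm (fact_rGamma n z) * q ^ j"
    if "n \<ge> N" "z \<in> K" for n j z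
  proof (induction j)
    case (Suc j)
    have nz: "of_nat (n + j) - z \<noteq> 0" using N[of "n + j" z] that by force
    have "norm (fact_rGamma (n + Suc j) z)
        = norm (of_nat (Suc (n + j)) / (of_nat (n + j) - z)) * norm (fact_rGamma (n + j) z)"
      by (simp only: add_Suc_right fact_rGamma_Suc[OF nz] norm_mult)
    also have "\<dots> \<le> q * (norm (fact_rGamma n z) * q ^ j)"
      using N[of "n + j" z] that Suc q by (intro mult_mono) auto
    finally show ?case by (simp add: algebra_simps)
  qed auto
  have "\<exists>B. \<forall>z\<in>K. norm (hyp_coeff 1 (- z) m * fact_rGamma n z) \<le> B" for m n
  proof -
    have "continuous_on K (\<lambda>z. hyp_coeff 1 (- z) m * fact_rGamma n z)"
      unfolding hyp_coeff_def fact_rGamma_def by (intro continuous_intros) auto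
    hence "bounded ((\<lambda>z. hyp_coeff 1 (- z) m * fact_rGamma n z) ` K)"
      using K compact_continuous_image compact_imp_bounded by blast
    thus ?thesis by (auto simp: bounded_iff)
  qed
  then obtain B where B: "\<And>m n z. z \<in> K \<Longrightarrow> norm (hyp_coeff 1 (- z) m * fact_rGamma n z) \<le> B m n"
    by metis
  define C where "C = (\<Sum>m\<le>N. \<Sum>n\<le>N. \<bar>B m n\<bar>)"
  have C: "norm (hyp_coeff 1 (- z) m * fact_rGamma n z) \<le> C" if "m \<le> N" "n \<le> N" "z \<in> K" for m n z
  proof -
    have "norm (hyp_coeff 1 (- z) m * fact_rGamma n z) \<le> \<bar>B m n\<bar>" using B[OF that(3), of m n] by linarith
    also have "\<dots> \<le> (\<Sum>n\<le>N. \<bar>B m n\<bar>)" using that by (intro member_le_sum) auto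
    also have "\<dots> \<le> C" unfolding C_def using that
      by (intro member_le_sum[of m _ "\<lambda>m. \<Sum>n\<le>N. \<bar>B m n\<bar>"]) (auto intro: sum_nonneg)
    finally show ?thesis .
  qed
  have C0: "C \<ge> 0" unfolding C_def by (intro sum_nonneg) auto
  show ?thesis
  proof (intro exI[of _ C] allI ballI)
    fix m j z assume z: "z \<in> K"
    define h where "h = hyp_coeff 1 (- z) m"
    have step: "norm (h * fact_rGamma (n + i) z) \<le> norm (h * fact_rGamma n z) * q ^ i" if "n \<ge> N" for n i
      using mult_left_mono[OF growth[OF that z, of i], of "norm h"] by (simp add: norm_mult mult.assoc)
    \<comment> \<open>the path from \<open>m\<close> to \<open>m + j\<close> lies above \<open>N\<close>, lies below \<open>N\<close>, or crosses \<open>N\<close>; in the last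
      case the estimate starts at \<open>N\<close>\<close>
    consider "m \<ge> N" | "m < N" "m + j \<le> N" | "m < N" "m + j > N" by linarith
    thus "norm (hyp_coeff 1 (- z) m * fact_rGamma (m + j) z) \<le> C * q ^ j"
    proof cases
      case 1
      \<comment> \<open>the product at \<open>(m, m)\<close> does not depend on \<open>m\<close>, so the bound at \<open>(0, 0)\<close> applies\<close>
      have "norm (h * fact_rGamma m z) \<le> C"
        using C[of 0 0 z] z hyp_coeff_mult_fact_rGamma[of z m] hyp_coeff_mult_fact_rGamma[of z 0]
        by (simp add: h_def)
      hence "norm (h * fact_rGamma m z) * q ^ j \<le> C * q ^ j" using q by (intro mult_right_mono) auto
      thus ?thesis using step[OF 1, of j] by (simp add: h_def)
    next
      case 2
      have "C * 1 \<le> C * q ^ j" using C0 q by (intro mult_left_mono) auto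
      thus ?thesis using C[of m "m + j" z] 2 z by simp
    next
      case 3
      define i where "i = m + j - N"
      have i: "m + j = N + i" "i \<le> j" using 3 by (auto simp: i_def)
      have "norm (h * fact_rGamma (N + i) z) \<le> norm (h * fact_rGamma N z) * q ^ i" by (rule step) simp
      also have "\<dots> \<le> C * q ^ j"
        using C[of m N z] 3 z i q C0 by (intro mult_mono power_increasing) (auto simp: h_def)
      finally show ?thesis by (simp add: i h_def)
    qed
  qed
qed

text \<open>
  For fixed \<open>j\<close>, the product differs from \<open>1 / \<Gamma>(- z)\<close> by \<open>j\<close> factors \<open>(n + 1) / (n - z)\<close>, each of
  which tends to 1.
\<close>
lemma uniform_limit_hyp_coeff_fact_rGamma:
  assumes K: "compact K"
  shows "uniform_limit K (\<lambda>m z. hyp_coeff 1 (- z) m * fact_rGamma (m + j) z) (\<lambda>z. rGamma (- z)) sequentially"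
proof (induction j)
  case 0
  show ?case by (simp add: hyp_coeff_mult_fact_rGamma uniform_limit_const)
next
  case (Suc j)
  have bK: "bounded K" using K by (rule compact_imp_bounded)
  have b: "bounded ((\<lambda>z. rGamma (- z)) ` K)"
    by (intro compact_imp_bounded compact_continuous_image continuous_intros K)
  have "uniform_limit K (\<lambda>m z. of_nat (Suc (m + j)) / (of_nat (m + j) - z)) (\<lambda>_. 1) sequentially"
    by (rule filterlim_compose[OF uniform_limit_Suc_ratio[OF bK] filterlim_add_const_nat_at_top])
  from uniform_lim_mult[OF this Suc.IH _ b]
  have *: "uniform_limit K (\<lambda>m z. of_nat (Suc (m + j)) / (of_nat (m + j) - z) *
      (hyp_coeff 1 (- z) m * fact_rGamma (m + j) z)) (\<lambda>z. rGamma (- z)) sequentially"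
    by (simp add: image_constant_conv del: of_nat_Suc of_nat_add)
  have "\<forall>\<^sub>F m in sequentially. \<forall>z\<in>K. norm (of_nat (m + j) - z) \<ge> 1"
    by (rule eventually_compose_filterlim[OF eventually_of_nat_minus_ge[OF bK] filterlim_add_const_nat_at_top])
  hence "\<forall>\<^sub>F m in sequentially. \<forall>z\<in>K. of_nat (Suc (m + j)) / (of_nat (m + j) - z) *
      (hyp_coeff 1 (- z) m * fact_rGamma (m + j) z) = hyp_coeff 1 (- z) m * fact_rGamma (m + Suc j) z"
  proof eventually_elim
    case (elim m)
    hence "of_nat (m + j) - z \<noteq> 0" if "z \<in> K" for z using that by fastforce
    thus ?case by (simp add: fact_rGamma_Suc del: of_nat_Suc of_nat_add)
  qed
  with * show ?case by (subst (asm) uniform_limit_cong) auto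
qed

text \<open>
  Darboux's principle, uniformly in \<open>z\<close>: the factor \<open>w(t) = (1 - c t) powr (- d / c)\<close> is analytic in a
  disc larger than the unit disc, so near the dominant singularity \<open>t = 1\<close> it acts as the constant
  \<open>w(1)\<close>, the sum of its coefficients. Since normalization by \<open>fact_rGamma\<close> replaces division by
  the coefficients of \<open>(1 - t) powr z\<close>, the points where these vanish are included.
\<close>
lemma uniform_limit_conv_coeff:
  fixes c :: complex and d :: "complex \<Rightarrow> complex"
  assumes K: "compact K" and c: "norm c < 1" and d: "continuous_on K d"
  shows "uniform_limit K (\<lambda>n z. fact_rGamma n z * conv_coeff c (d z) z n)
           (\<lambda>z. rGamma (- z) * (\<Sum>j. hyp_coeff c (d z) j)) sequentially"
proof -
  \<comment> \<open>a \<open>q > 1\<close> that still satisfies \<open>|c| q < 1\<close>\<close>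
  define q where "q = 2 / (1 + norm c)"
  have q: "q > 1" "norm c * q < 1"
    using c add_pos_nonneg[OF zero_less_one norm_ge_zero[of c]] by (auto simp: q_def field_simps)
  obtain D where D: "D \<ge> 0" "\<And>z. z \<in> K \<Longrightarrow> norm (d z) \<le> D"
    using compact_imp_bounded[OF compact_continuous_image[OF d K]] less_imp_le
    unfolding bounded_pos by (metis imageI)
  obtain C where C: "\<And>m j z. z \<in> K \<Longrightarrow> norm (hyp_coeff 1 (- z) m * fact_rGamma (m + j) z) \<le> C * q ^ j"
    using fact_rGamma_bound[OF K q(1)] by blast
  define a where "a j n z =
    (if j \<le> n then hyp_coeff c (d z) j * (hyp_coeff 1 (- z) (n - j) * fact_rGamma n z) else 0)" for j n z
  have hc: "norm (hyp_coeff c (d z) j) \<le> hyp_coeff (norm c) D j" if "z \<in> K" for z j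
    by (rule norm_hyp_coeff_le[OF D(2)[OF that]])
  have "uniform_limit K (\<lambda>n z. \<Sum>j. a j n z) (\<lambda>z. \<Sum>j. hyp_coeff c (d z) j * rGamma (- z)) sequentially"
  proof (rule uniform_tannery)
    fix j
    have "uniform_limit K (\<lambda>n z. hyp_coeff 1 (- z) (n - j) * fact_rGamma (n - j + j) z)
        (\<lambda>z. rGamma (- z)) sequentially"
      by (rule filterlim_compose[OF uniform_limit_hyp_coeff_fact_rGamma[OF K] filterlim_minus_const_nat_at_top])
    moreover have "bounded ((\<lambda>z. hyp_coeff c (d z) j) ` K)" unfolding hyp_coeff_def
      by (intro compact_imp_bounded compact_continuous_image continuous_intros K d) auto
    moreover have "bounded ((\<lambda>z. rGamma (- z)) ` K)"
      by (intro compact_imp_bounded compact_continuous_image continuous_intros K)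
    ultimately have "uniform_limit K (\<lambda>n z. hyp_coeff c (d z) j * (hyp_coeff 1 (- z) (n - j) * fact_rGamma (n - j + j) z))
        (\<lambda>z. hyp_coeff c (d z) j * rGamma (- z)) sequentially"
      by (intro uniform_lim_mult uniform_limit_const)
    moreover have "\<forall>\<^sub>F n in sequentially. \<forall>z\<in>K.
        hyp_coeff c (d z) j * (hyp_coeff 1 (- z) (n - j) * fact_rGamma (n - j + j) z) = a j n z"
      using eventually_ge_at_top[of j] by eventually_elim (simp add: a_def)
    ultimately show "uniform_limit K (a j) (\<lambda>z. hyp_coeff c (d z) j * rGamma (- z)) sequentially"
      by (subst (asm) uniform_limit_cong) auto
  next
    fix j n z assume z: "z \<in> K"
    have "0 \<le> C" using order_trans[OF norm_ge_zero C[OF z, of 0 0]] by simp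
    moreover have "0 \<le> hyp_coeff (norm c) D j" using hc[OF z, of j] norm_ge_zero order_trans by blast
    ultimately show "norm (a j n z) \<le> C * (hyp_coeff (norm c) D j * q ^ j)"
      using mult_mono[OF hc[OF z, of j] C[OF z, of "n - j" j]] q
      by (auto simp: a_def norm_mult algebra_simps)
  next
    show "summable (\<lambda>j. C * (hyp_coeff (norm c) D j * q ^ j))"
      using q D by (intro summable_mult summable_hyp_coeff) auto
  qed
  moreover have "(\<Sum>j. a j n z) = fact_rGamma n z * conv_coeff c (d z) z n" for n z
  proof -
    have "(\<Sum>j. a j n z) = (\<Sum>j\<le>n. a j n z)" by (rule suminf_finite) (auto simp: a_def)
    thus ?thesis by (simp add: a_def conv_coeff_def sum_distrib_left mult_ac)
  qed
  moreover have prod_sum: "(\<Sum>j. hyp_coeff c (d z) j * rGamma (- z)) = rGamma (- z) * (\<Sum>j. hyp_coeff c (d z) j)"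
    if "z \<in> K" for z
  proof -
    have "summable (\<lambda>j. hyp_coeff (norm c) D j * 1 ^ j)"
      using c D by (intro summable_hyp_coeff) auto
    hence "summable (\<lambda>j. hyp_coeff c (d z) j)"
      by (rule summable_comparison_test') (use hc[OF that] in auto)
    thus ?thesis by (simp add: suminf_mult mult.commute)
  qed
  ultimately show ?thesis
    by (subst (asm) uniform_limit_cong'[OF _ prod_sum]) auto
qed

section \<open>The limits of the Charlier and Meixner polynomials\<close>

text \<open>
  The functional equation of \<open>1 / \<Gamma>\<close>, iterated. It moves the argument of \<open>theta\<close> at the cost of
  a polynomial in \<open>n\<close> of degree \<open>k\<close>, and no division occurs.
\<close>
lemma theta_shift: "theta \<kappa> n z = pochhammer (of_nat n - z) k * theta \<kappa> n (z - of_nat k)"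
  using pochhammer_rGamma[of "of_nat n - z" k] by (simp add: theta_def algebra_simps)

text \<open>
  Here \<open>c = 0\<close> and \<open>d = \<mu>\<close>: the factor \<open>w(t)\<close> of the generating function is \<open>exp (\<mu> t)\<close>, and its
  value at \<open>t = 1\<close> is the factor \<open>exp \<mu>\<close> of the limit.
\<close>
lemma charlier_limit:
  assumes "compact K"
  shows "uniform_limit K (\<lambda>n z. theta (-1) n z * poly (charlier \<mu> n) z) (charlier_phi \<mu>) sequentially"
proof -
  have "theta (-1) n z * poly (charlier \<mu> n) z = fact_rGamma n z * conv_coeff 0 (of_real \<mu>) z n" for n z
  proof -
    have "(-1) ^ n * poly (charlier \<mu> n) z = fact n * conv_coeff 0 (of_real \<mu>) z n"
      unfolding charlier_def by (rule monic_ops_eq_conv_coeff) (simp_all add: algebra_simps)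
    thus ?thesis by (simp add: theta_def fact_rGamma_def algebra_simps)
  qed
  moreover have "(\<Sum>j. hyp_coeff 0 (of_real \<mu>) j) = (of_real (exp \<mu>) :: complex)"
  proof -
    have "(of_real (exp \<mu>) :: complex) = exp (of_real \<mu>)" by (simp add: exp_of_real)
    thus ?thesis by (simp add: hyp_coeff_def exp_def scaleR_conv_of_real field_simps)
  qed
  ultimately show ?thesis
    using uniform_limit_conv_coeff[of K 0 "\<lambda>_. of_real \<mu>"] assms
    by (simp add: charlier_phi_def[abs_def] mult.commute)
qed

text \<open>
  The binomial series for \<open>(1 - \<mu> t) powr (- a)\<close> at \<open>t = 1\<close>.
\<close>
lemma suminf_hyp_coeff_binomial:
  fixes a :: complex
  assumes "0 < \<mu>" "\<mu> < 1"
  shows "(\<Sum>j. hyp_coeff (of_real \<mu>) (of_real \<mu> * a) j) = exp (- (a * of_real (ln (1 - \<mu>))))"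
proof -
  have "hyp_coeff (of_real \<mu>) (of_real \<mu> * a) j = (- a gchoose j) * (- of_real \<mu>) ^ j" for j
  proof -
    have "(\<Prod>i<j. of_real \<mu> * a + of_nat i * of_real \<mu>) = of_real \<mu> ^ j * pochhammer a j"
      by (induction j) (simp_all add: pochhammer_Suc algebra_simps)
    moreover have "(-1) ^ j * (- of_real \<mu>) ^ j = (of_real \<mu> ^ j :: complex)"
      by (simp flip: power_mult_distrib)
    ultimately show ?thesis
      by (simp add: hyp_coeff_def gbinomial_pochhammer mult_ac)
  qed
  moreover have "(\<lambda>j. (- a gchoose j) * (- of_real \<mu>) ^ j) sums (1 + - of_real \<mu>) powr (- a)"
    by (rule gen_binomial_complex) (use assms in simp)
  moreover have "(1 + - of_real \<mu>) powr (- a) = exp (- (a * of_real (ln (1 - \<mu>))))"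
  proof -
    have "Ln (of_real (1 - \<mu>)) = of_real (ln (1 - \<mu>))"
      by (rule Ln_of_real) (use assms in simp)
    moreover have "(1 - of_real \<mu> :: complex) \<noteq> 0"
      using assms by (metis eq_iff_diff_eq_0 less_irrefl of_real_1 of_real_eq_iff)
    ultimately show ?thesis by (simp add: powr_def)
  qed
  ultimately show ?thesis by (simp add: sums_iff)
qed

text \<open>
  Here \<open>c = \<mu>\<close> and \<open>d = \<mu> (\<gamma> + z)\<close>: the factor \<open>w(t)\<close> of the generating function is
  \<open>(1 - \<mu> t) powr (- \<gamma> - z)\<close>.
\<close>
lemma meixner_limit:
  assumes "0 < \<mu>" "\<mu> < 1" "compact K"
  shows "uniform_limit K (\<lambda>n z. theta (\<mu> - 1) n z * poly (meixner \<gamma> \<mu> n) z) (meixner_phi \<gamma> \<mu>) sequentially"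
proof -
  have "theta (\<mu> - 1) n z * poly (meixner \<gamma> \<mu> n) z
      = fact_rGamma n z * conv_coeff (of_real \<mu>) (of_real \<mu> * (of_real \<gamma> + z)) z n" for n z
  proof -
    have nz: "(1 - of_real \<mu> :: complex) \<noteq> 0" "(of_real \<mu> - 1 :: complex) \<noteq> 0"
      using assms by (metis eq_iff_diff_eq_0 less_irrefl of_real_1 of_real_eq_iff)+
    have "of_real (\<mu> - 1) ^ n * poly (meixner \<gamma> \<mu> n) z
        = fact n * conv_coeff (of_real \<mu>) (of_real \<mu> * (of_real \<gamma> + z)) z n"
      unfolding meixner_def
    proof (rule monic_ops_eq_conv_coeff)
      fix n
      show "of_real (\<mu> - 1) * (z - of_real ((real n * (1 + \<mu>) + \<mu> * \<gamma>) / (1 - \<mu>)))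
          = of_nat n * (1 + of_real \<mu>) + of_real \<mu> * (of_real \<gamma> + z) - z"
        using nz by (simp add: field_simps)
      show "(of_real (\<mu> - 1))\<^sup>2 * of_real (real (Suc n) * \<mu> * (real (Suc n) - 1 + \<gamma>) / (\<mu> - 1)\<^sup>2)
          = of_nat (Suc n) * (of_nat n * of_real \<mu> + of_real \<mu> * (of_real \<gamma> + z) - of_real \<mu> * z)"
        using nz by (simp add: divide_simps) (simp add: algebra_simps)
    qed
    thus ?thesis by (simp add: theta_def fact_rGamma_def algebra_simps)
  qed
  moreover have "rGamma (- z) * (\<Sum>j. hyp_coeff (of_real \<mu>) (of_real \<mu> * (of_real \<gamma> + z)) j)
      = meixner_phi \<gamma> \<mu> z" for z
    using assms by (simp add: suminf_hyp_coeff_binomial meixner_phi_def exp_minus divide_inverse)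
  moreover have "uniform_limit K
      (\<lambda>n z. fact_rGamma n z * conv_coeff (of_real \<mu>) (of_real \<mu> * (of_real \<gamma> + z)) z n)
      (\<lambda>z. rGamma (- z) * (\<Sum>j. hyp_coeff (of_real \<mu>) (of_real \<mu> * (of_real \<gamma> + z)) j)) sequentially"
    using assms by (intro uniform_limit_conv_coeff continuous_intros) auto
  ultimately show ?thesis by simp
qed

section \<open>Passing to forward and backward differences\<close>

text \<open>
  The shifted term of a forward difference is negligible: since \<open>theta \<kappa> n z\<close> is smaller than
  \<open>theta \<kappa> n (z + 1)\<close> by the factor \<open>1 / (n - z - 1)\<close>, the product \<open>theta \<kappa> n z * f n (z + 1)\<close> tends to 0.
  Each difference therefore only contributes the sign of the unshifted term.
\<close>
lemma fwd_diff_limit: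
  fixes f :: "nat \<Rightarrow> complex \<Rightarrow> complex"
  assumes lim: "\<And>K. compact K \<Longrightarrow> uniform_limit K (\<lambda>n z. theta \<kappa> n z * f n z) g sequentially"
    and g: "continuous_on UNIV g" and K: "compact K"
  shows "uniform_limit K (\<lambda>n z. theta \<kappa> n z * (fwd_diff ^^ k) (f n) z) (\<lambda>z. (-1) ^ k * g z) sequentially"
  using K
proof (induction k arbitrary: K)
  case 0
  thus ?case by (simp add: lim)
next
  case (Suc k)
  define F where "F n = (fwd_diff ^^ k) (f n)" for n
  define K' where "K' = (\<lambda>z. z + 1) ` K"
  have cK': "compact K'"
    unfolding K'_def by (intro compact_continuous_image continuous_intros Suc.prems)
  have bK': "bounded K'" using cK' by (rule compact_imp_bounded)
  have cont: "continuous_on A (\<lambda>z. (-1) ^ k * g z)" for A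
    by (intro continuous_intros continuous_on_subset[OF g]) auto
  have "bounded ((\<lambda>z. (-1) ^ k * g z) ` K')"
    by (rule compact_imp_bounded[OF compact_continuous_image[OF cont cK']])
  hence "uniform_limit K' (\<lambda>n z. 1 / (of_nat n - z) * (theta \<kappa> n z * F n z)) (\<lambda>z. 0 * ((-1) ^ k * g z)) sequentially"
    unfolding F_def
    by (intro uniform_lim_mult uniform_limit_inverse_of_nat_minus Suc.IH cK' bK')
       (auto simp: image_constant_conv)
  moreover have "\<forall>\<^sub>F n in sequentially. \<forall>z\<in>K'.
      1 / (of_nat n - z) * (theta \<kappa> n z * F n z) = theta \<kappa> n (z - 1) * F n z"
    using eventually_of_nat_minus_ge[OF bK', of 1]
  proof eventually_elim
    case (elim n)
    show ?case
    proof
      fix z assume "z \<in> K'"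
      hence "of_nat n - z \<noteq> 0" using elim by fastforce
      thus "1 / (of_nat n - z) * (theta \<kappa> n z * F n z) = theta \<kappa> n (z - 1) * F n z"
        using theta_shift[of \<kappa> n z 1] by simp
    qed
  qed
  ultimately have "uniform_limit K' (\<lambda>n z. theta \<kappa> n (z - 1) * F n z) (\<lambda>_. 0) sequentially"
    by (subst (asm) uniform_limit_cong) auto
  hence "uniform_limit K (\<lambda>n z. theta \<kappa> n (z + 1 - 1) * F n (z + 1)) (\<lambda>_. 0) sequentially"
    by (rule uniform_limit_compose') (auto simp: K'_def)
  note uniform_limit_minus[OF this Suc.IH[OF Suc.prems]]
  moreover have "(fwd_diff ^^ Suc k) (f n) z = F n (z + 1) - F n z" for n z
    by (simp add: F_def fwd_diff_def[of "(fwd_diff ^^ k) (f n)"])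
  ultimately show ?case by (simp add: F_def right_diff_distrib)
qed

lemma funpow_bwd_diff: "(bwd_diff ^^ k) f z = (fwd_diff ^^ k) f (z - of_nat k)"
proof (induction k arbitrary: z)
  case (Suc k)
  have "(bwd_diff ^^ Suc k) f z = (bwd_diff ^^ k) f z - (bwd_diff ^^ k) f (z - 1)"
    by (simp add: bwd_diff_def)
  thus ?case unfolding Suc by (simp add: fwd_diff_def[of "(fwd_diff ^^ k) f"] algebra_simps)
qed simp

lemma uniform_limit_pochhammer_ratio:
  fixes K :: "complex set"
  assumes "bounded K"
  shows "uniform_limit K (\<lambda>n z. pochhammer (of_nat n - z) k / of_nat n ^ k) (\<lambda>_. 1) sequentially"
proof (induction k)
  case (Suc k)
  have b: "bounded ((\<lambda>z. of_nat k - z) ` K)"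
    using assms by (intro bounded_minus_comp) (auto simp: image_constant_conv)
  have "uniform_limit K (\<lambda>n z. 1 / of_nat n :: complex) (\<lambda>_. 0) sequentially"
    using lim_1_over_n[where 'a = complex] by (simp add: uniform_limit_iff tendsto_iff)
  hence "uniform_limit K (\<lambda>n z. pochhammer (of_nat n - z) k / of_nat n ^ k * (1 + (of_nat k - z) * (1 / of_nat n)))
      (\<lambda>z. 1 * (1 + (of_nat k - z) * 0)) sequentially"
    using b by (intro uniform_lim_mult uniform_limit_add uniform_limit_const Suc)
       (auto simp: image_constant_conv)
  moreover have "\<forall>\<^sub>F n in sequentially. \<forall>z\<in>K.
      pochhammer (of_nat n - z) k / of_nat n ^ k * (1 + (of_nat k - z) * (1 / of_nat n))
      = pochhammer (of_nat n - z) (Suc k) / of_nat n ^ Suc k"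
    using eventually_gt_at_top[of 0]
    by eventually_elim (auto simp: pochhammer_Suc field_simps)
  ultimately show ?case by (subst (asm) uniform_limit_cong) auto
qed (simp add: uniform_limit_const)

text \<open>
  A backward difference is a forward difference taken \<open>k\<close> steps to the left, and moving \<open>theta\<close>
  by these \<open>k\<close> steps produces a factor asymptotic to \<open>n ^ k\<close>. This explains both the normalization
  and the argument \<open>z - k\<close> of the limit.
\<close>
lemma bwd_diff_limit:
  fixes f :: "nat \<Rightarrow> complex \<Rightarrow> complex"
  assumes lim: "\<And>K. compact K \<Longrightarrow> uniform_limit K (\<lambda>n z. theta \<kappa> n z * f n z) g sequentially"
    and g: "continuous_on UNIV g" and K: "compact K"
  shows "uniform_limit K (\<lambda>n z. theta \<kappa> n z / of_nat n ^ k * (bwd_diff ^^ k) (f n) z)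
           (\<lambda>z. (-1) ^ k * g (z - of_nat k)) sequentially"
proof -
  define K' where "K' = (\<lambda>z. z - of_nat k) ` K"
  have "compact K'"
    unfolding K'_def by (intro compact_continuous_image continuous_intros K)
  from fwd_diff_limit[OF lim g this]
  have fwd: "uniform_limit K (\<lambda>n z. theta \<kappa> n (z - of_nat k) * (fwd_diff ^^ k) (f n) (z - of_nat k))
      (\<lambda>z. (-1) ^ k * g (z - of_nat k)) sequentially"
    by (rule uniform_limit_compose') (auto simp: K'_def)
  have bounded: "bounded ((\<lambda>z. (-1) ^ k * g (z - of_nat k)) ` K)"
    by (rule compact_imp_bounded[OF compact_continuous_image[OF _ K]])
       (intro continuous_intros continuous_on_compose2[OF g], auto)
  have "uniform_limit K (\<lambda>n z. pochhammer (of_nat n - z) k / of_nat n ^ k *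
      (theta \<kappa> n (z - of_nat k) * (fwd_diff ^^ k) (f n) (z - of_nat k)))
      (\<lambda>z. 1 * ((-1) ^ k * g (z - of_nat k))) sequentially"
    by (rule uniform_lim_mult[OF uniform_limit_pochhammer_ratio[OF compact_imp_bounded[OF K]] fwd _ bounded])
       (auto simp: image_constant_conv)
  moreover have "pochhammer (of_nat n - z) k / of_nat n ^ k *
      (theta \<kappa> n (z - of_nat k) * (fwd_diff ^^ k) (f n) (z - of_nat k))
      = theta \<kappa> n z / of_nat n ^ k * (bwd_diff ^^ k) (f n) z" for n z
    by (simp add: theta_shift[of \<kappa> n z k] funpow_bwd_diff)
  ultimately show ?thesis by (simp only: mult_1_left)
qed

section \<open>The limit functions\<close>

lemma rGamma_falling_fact:
  "rGamma (- z) = (-1) ^ k * falling_fact z k * rGamma (- (z - of_nat k) :: complex)"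
proof -
  have "pochhammer (- z) k = (-1) ^ k * falling_fact z k"
    by (induction k) (simp_all add: pochhammer_Suc falling_fact_def algebra_simps)
  thus ?thesis using pochhammer_rGamma[of "- z" k] by (simp add: add.commute)
qed

lemma falling_fact_eq_0_iff:
  "falling_fact z k = 0 \<longleftrightarrow> z \<in> of_nat ` {..<k}" for z :: complex
  by (auto simp: falling_fact_def)

lemma charlier_phi_shift:
  assumes "z \<notin> of_nat ` {..<k}"
  shows "(-1) ^ k * charlier_phi \<mu> (z - of_nat k) = charlier_phi \<mu> z / falling_fact z k"
proof -
  have "falling_fact z k \<noteq> 0" using assms by (simp add: falling_fact_eq_0_iff)
  thus ?thesis unfolding charlier_phi_def
    by (subst rGamma_falling_fact[of z k]) (simp add: field_simps)
qed

lemma meixner_phi_shift: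
  assumes "z \<notin> of_nat ` {..<k}" "\<mu> < 1"
  shows "(-1) ^ k * meixner_phi \<gamma> \<mu> (z - of_nat k) = (1 - of_real \<mu>) ^ k * meixner_phi \<gamma> \<mu> z / falling_fact z k"
proof -
  define L :: complex where "L = of_real (ln (1 - \<mu>))"
  have nz: "falling_fact z k \<noteq> 0" using assms by (simp add: falling_fact_eq_0_iff)
  have L: "exp L = 1 - of_real \<mu>"
    using assms by (simp add: L_def exp_of_real)
  have "exp ((of_real \<gamma> + z) * L) = exp ((of_real \<gamma> + (z - of_nat k)) * L) * exp (of_nat k * L)"
    by (simp add: exp_add[symmetric] algebra_simps)
  also have "exp (of_nat k * L) = (1 - of_real \<mu>) ^ k"
    by (simp add: exp_of_nat_mult L)
  finally have E: "exp ((of_real \<gamma> + z) * L) = exp ((of_real \<gamma> + (z - of_nat k)) * L) * (1 - of_real \<mu>) ^ k" .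
  have "(1 - of_real \<mu>) ^ k \<noteq> (0 :: complex)" using L by (metis exp_not_eq_zero power_not_zero)
  thus ?thesis unfolding meixner_phi_def L_def[symmetric] E
    by (subst rGamma_falling_fact[of z k]) (use nz assms in \<open>simp add: field_simps\<close>)
qed

lemma holomorphic_charlier_phi: "charlier_phi \<mu> holomorphic_on A"
  unfolding charlier_phi_def[abs_def] by (intro holomorphic_intros)

lemma holomorphic_meixner_phi: "meixner_phi \<gamma> \<mu> holomorphic_on A"
  unfolding meixner_phi_def[abs_def] by (intro holomorphic_intros) auto

text \<open>
  Any \<open>g\<close> as in the hypotheses is the required extension: a disc of radius 1 around an integer
  contains no other integer.
\<close>
lemma removable_sing_at_of_nat:
  assumes g: "g holomorphic_on UNIV" and eq: "\<And>z. z \<notin> of_nat ` {..<k} \<Longrightarrow> g z = f z"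
  shows "removable_sing_at f (of_nat j)"
  unfolding removable_sing_at_def
proof (intro exI conjI ballI)
  show "g holomorphic_on ball (of_nat j) 1" using g by (rule holomorphic_on_subset) auto
  fix z :: complex assume z: "z \<in> ball (of_nat j) 1 - {of_nat j}"
  have "z \<noteq> of_nat i" for i
  proof
    assume i: "z = of_nat i"
    have "dist (of_nat j :: complex) (of_nat i) = \<bar>real j - real i\<bar>"
      by (metis dist_norm norm_of_real of_real_diff of_real_of_nat_eq)
    thus False using z i by (cases i j rule: linorder_cases) auto
  qed
  thus "g z = f z" using eq by blast
qed auto

theorem theorem3p1:
  fixes k :: nat and \<mu> \<gamma> \<kappa> \<rho> :: real
    and P :: "nat \<Rightarrow> complex poly" and \<phi> :: "complex \<Rightarrow> complex"
  assumes family: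
    "(0 < \<mu> \<and> P = charlier \<mu> \<and> \<kappa> = -1 \<and> \<rho> = 1 \<and> \<phi> = charlier_phi \<mu>) \<or>
     (0 < \<gamma> \<and> 0 < \<mu> \<and> \<mu> < 1 \<and> P = meixner \<gamma> \<mu> \<and> \<kappa> = \<mu> - 1 \<and> \<rho> = 1 - \<mu> \<and> \<phi> = meixner_phi \<gamma> \<mu>)"
  shows
    "(\<forall>K. compact K \<longrightarrow>
        uniform_limit K (\<lambda>n z. theta \<kappa> n z * (fwd_diff ^^ k) (poly (P n)) z)
          (\<lambda>z. (-1) ^ k * \<phi> z) sequentially) \<and>
     (\<forall>K. compact K \<longrightarrow>
        uniform_limit K (\<lambda>n z. theta \<kappa> n z / of_nat n ^ k * (bwd_diff ^^ k) (poly (P n)) z)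
          (\<lambda>z. (-1) ^ k * \<phi> (z - of_nat k)) sequentially) \<and>
     (k \<ge> 1 \<longrightarrow>
        (\<forall>z. z \<notin> of_nat ` {..<k} \<longrightarrow>
           (-1) ^ k * \<phi> (z - of_nat k) = of_real \<rho> ^ k / falling_fact z k * \<phi> z \<and>
           (0 < \<mu> \<longrightarrow>
              (-1) ^ k * charlier_phi \<mu> (z - of_nat k) = charlier_phi \<mu> z / falling_fact z k) \<and>
           (0 < \<gamma> \<and> 0 < \<mu> \<and> \<mu> < 1 \<longrightarrow>
              (-1) ^ k * meixner_phi \<gamma> \<mu> (z - of_nat k)
                = (1 - of_real \<mu>) ^ k * meixner_phi \<gamma> \<mu> z / falling_fact z k)) \<and>
        (\<forall>j<k. removable_sing_at (\<lambda>z. of_real \<rho> ^ k * \<phi> z / falling_fact z k) (of_nat j))) \<and>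
     (\<lambda>z. (-1) ^ k * \<phi> z) holomorphic_on UNIV \<and>
     (\<lambda>z. (-1) ^ k * \<phi> (z - of_nat k)) holomorphic_on UNIV"
proof -
  have lim: "uniform_limit K (\<lambda>n z. theta \<kappa> n z * poly (P n) z) \<phi> sequentially" if "compact K" for K
    using family charlier_limit meixner_limit that by blast
  have hol: "\<phi> holomorphic_on UNIV"
    using family holomorphic_charlier_phi holomorphic_meixner_phi by blast
  hence cont: "continuous_on UNIV \<phi>" by (rule holomorphic_on_imp_continuous_on)
  have hol': "(\<lambda>z. (-1) ^ k * \<phi> (z - of_nat k)) holomorphic_on UNIV"
  proof (rule holomorphic_on_mult[OF holomorphic_on_const])
    have "(\<lambda>z. z - of_nat k) holomorphic_on (UNIV :: complex set)" by (intro holomorphic_intros)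
    from holomorphic_on_compose[OF this holomorphic_on_subset[OF hol subset_UNIV]]
    show "(\<lambda>z. \<phi> (z - of_nat k)) holomorphic_on UNIV" by (simp only: o_def)
  qed
  have shift: "(-1) ^ k * \<phi> (z - of_nat k) = of_real \<rho> ^ k * \<phi> z / falling_fact z k"
    if "z \<notin> of_nat ` {..<k}" for z
    using family charlier_phi_shift[OF that] meixner_phi_shift[OF that] by auto
  show ?thesis
  proof (intro conjI allI impI)
    fix z :: complex assume z: "z \<notin> of_nat ` {..<k}"
    show "(-1) ^ k * \<phi> (z - of_nat k) = of_real \<rho> ^ k / falling_fact z k * \<phi> z"
      using shift[OF z] by simp
  next
    fix K :: "complex set" assume "compact K"
    show "uniform_limit K (\<lambda>n z. theta \<kappa> n z * (fwd_diff ^^ k) (poly (P n)) z)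
          (\<lambda>z. (-1) ^ k * \<phi> z) sequentially"
      by (rule fwd_diff_limit[OF lim cont \<open>compact K\<close>])
    show "uniform_limit K (\<lambda>n z. theta \<kappa> n z / of_nat n ^ k * (bwd_diff ^^ k) (poly (P n)) z)
          (\<lambda>z. (-1) ^ k * \<phi> (z - of_nat k)) sequentially"
      by (rule bwd_diff_limit[OF lim cont \<open>compact K\<close>])
  qed (use hol' charlier_phi_shift meixner_phi_shift
        holomorphic_on_mult[OF holomorphic_on_const hol]
        removable_sing_at_of_nat[OF hol' shift] in blast)+
qed

end
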